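(* Let $n\ge 2$, let $M$ be a real symmetric positive definite $n\times n$ matrix, let $H(\xi)=\sqrt{\langle M\xi,\xi\rangle}$ for $\xi\in\mathbb{R}^n$, and let $B=\sqrt{M}$ be the unique symmetric positive definite matrix with $B^2=M$. Then for any $p>1$ and any $u\in W^{1,p}_{loc}(\mathbb{R}^n)$, setting $\widetilde{u}(x)=u(Bx)$, one has $$\int_{\mathbb{R}^{n}}|\nabla \widetilde{u}|^{p-2}\,\nabla \widetilde{u}\cdot\nabla\widetilde{\phi}\,dx=\int_{\mathbb{R}^{n}}\left[H^{p-1}(\nabla u)\,H_{\xi}(\nabla u)\cdot\nabla\phi\right](Bx)\,dx$$ for every $\phi\in C_{c}^1(\mathbb{R}^{n})$, where $\widetilde{\phi}(x)=\phi(Bx)$. In other words, in the weak sense, $\Delta_p \widetilde u = (\Delta_p^H u)(Bx)$ in $\mathbb{R}^n$.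
   Context: $H_\xi=\nabla H=(\partial H/\partial\xi_1,\dots,\partial H/\partial\xi_n)$ denotes the gradient of $H$ on $\mathbb{R}^n\setminus\{0\}$, and $H^{p-1}(\xi)$ means $(H(\xi))^{p-1}$. The vector fields $\xi\mapsto H^{p-1}(\xi)H_\xi(\xi)$ and $\xi\mapsto|\xi|^{p-2}\xi$ are taken to be $0$ at $\xi=0$ (their continuous extension, since $p>1$). The Finsler $p$-Laplacian associated with $H$ is $\Delta_{p}^{H}u=\sum_{i=1}^{n}\frac{\partial}{\partial x_{i}}\left(H^{p-1}(\nabla u)H_{\xi_{i}}(\nabla u)\right)$, and $\Delta_p u=\operatorname{div}(|\nabla u|^{p-2}\nabla u)$ is the classical $p$-Laplacian (the case where $H$ is the Euclidean norm). For $u\in W^{1,p}_{loc}(\mathbb{R}^n)$ these are understood weakly: $\Delta_p^Hu$ is the linear functional $\phi\mapsto-\int_{\mathbb{R}^n} H^{p-1}(\nabla u)H_\xi(\nabla u)\cdot\nabla\phi\,dx$ on $C^1_c(\mathbb{R}^n)$, and similarly for $\Delta_p$. In the integral identity, $[F](Bx)$ means that the function $F=H^{p-1}(\nabla u)H_\xi(\nabla u)\cdot\nabla\phi$ is evaluated at the point $Bx$. The weak identity $\Delta_p\widetilde u=(\Delta_p^Hu)(Bx)$ means exactly this integral identity for all $\phi\in C^1_c(\mathbb{R}^n)$. *)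

theory Defs
  imports "HOL-Analysis.Analysis"
begin

definition sym_pos_def :: "real^'n^'n \<Rightarrow> bool" where
  "sym_pos_def A \<longleftrightarrow> transpose A = A \<and> (\<forall>x. x \<noteq> 0 \<longrightarrow> (A *v x) \<bullet> x > 0)"

definition grad :: "(real^'n \<Rightarrow> real) \<Rightarrow> real^'n \<Rightarrow> real^'n" where
  "grad f x = (\<chi> i. deriv (\<lambda>t. f (x + t *\<^sub>R axis i 1)) 0)"

definition C1c :: "(real^'n \<Rightarrow> real) set" where
  "C1c = {\<phi>. (\<forall>x. \<phi> differentiable (at x)) \<and> continuous_on UNIV (grad \<phi>)
              \<and> compact (closure {x. \<phi> x \<noteq> 0})}"

definition Lp_loc :: "real \<Rightarrow> (real^'n \<Rightarrow> 'b::euclidean_space) set" where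
  "Lp_loc p = {f. f \<in> borel_measurable lebesgue
                  \<and> (\<forall>K. compact K \<longrightarrow> set_integrable lebesgue K (\<lambda>x. norm (f x) powr p))}"

definition is_weak_grad :: "(real^'n \<Rightarrow> real) \<Rightarrow> (real^'n \<Rightarrow> real^'n) \<Rightarrow> bool" where
  "is_weak_grad u G \<longleftrightarrow> u \<in> Lp_loc 1 \<and> G \<in> Lp_loc 1 \<and>
     (\<forall>\<phi>\<in>C1c. (\<integral>x. u x *\<^sub>R grad \<phi> x \<partial>lebesgue) = - (\<integral>x. \<phi> x *\<^sub>R G x \<partial>lebesgue))"

text \<open>A weak gradient is determined only up to a null set; \<^term>\<open>weak_grad u\<close> is an arbitrary
  but fixed representative.\<close>
definition weak_grad :: "(real^'n \<Rightarrow> real) \<Rightarrow> real^'n \<Rightarrow> real^'n" where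
  "weak_grad u = (SOME G. is_weak_grad u G)"

definition W1p_loc :: "real \<Rightarrow> (real^'n \<Rightarrow> real) set" where
  "W1p_loc p = {u. u \<in> Lp_loc p \<and> (\<exists>G. is_weak_grad u G \<and> G \<in> Lp_loc p)}"

text \<open>The value at the origin, where \<open>H\<close> need not be differentiable, is the continuous
  extension for \<open>p > 1\<close>.\<close>
definition finsler_field :: "real \<Rightarrow> (real^'n \<Rightarrow> real) \<Rightarrow> real^'n \<Rightarrow> real^'n" where
  "finsler_field p H \<xi> = (if \<xi> = 0 then 0 else (H \<xi> powr (p - 1)) *\<^sub>R grad H \<xi>)"

definition euclidean_field :: "real \<Rightarrow> real^'n \<Rightarrow> real^'n" where
  "euclidean_field p \<xi> = (if \<xi> = 0 then 0 else (norm \<xi> powr (p - 2)) *\<^sub>R \<xi>)"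

end

theory Submission
  imports Defs
begin

text \<open>Since \<open>M = B\<^sup>2\<close> with \<open>B\<close> symmetric, \<open>H(\<xi>) = |B \<xi>|\<close>, and a computation with the chain rule gives the
  pointwise identity \<open>H\<^bsup>p-1\<^esup>(\<xi>) \<nabla>H(\<xi>) \<cdot> \<eta> = |B \<xi>|\<^bsup>p-2\<^esup> (B \<xi>) \<cdot> (B \<eta>)\<close>
  (\<open>finsler_field_norm_matrix\<close>).  On the other hand \<open>u'(x) = u (B x)\<close> has the weak gradient
  \<open>B \<nabla>u(B x)\<close>, and \<open>\<phi>'(x) = \<phi> (B x)\<close> has the gradient \<open>B \<nabla>\<phi>(B x)\<close>.  With \<open>\<xi> = \<nabla>u(B x)\<close> and
  \<open>\<eta> = \<nabla>\<phi>(B x)\<close> the two integrands coincide almost everywhere, so the integrals are equal; they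
  converge because \<open>|\<nabla>u'|\<^bsup>p-1\<^esup>\<close> is locally integrable and \<open>\<nabla>\<phi>'\<close> is bounded with compact support
  (\<open>integrable_euclidean_field_grad\<close>).

  The work lies in the statement about weak gradients, \<open>W1p_loc_linear\<close>, which rests on two facts.

  First, weak gradients can be transported along a linear bijection (\<open>is_weak_grad_linear\<close>).  This
  takes the rule \<open>\<integral> f = c \<integral> f \<circ> A\<close> for an invertible matrix \<open>A\<close>, with any constant \<open>c > 0\<close>.
  Its existence is an instance of the uniqueness of Haar measure:
  \<open>nn_integral_linear_exchange\<close> derives it from translation and reflection invariance by Fubini's
  theorem.

  Secondly, a weak gradient is determined almost everywhere (\<open>is_weak_grad_unique\<close>); this is needed
  because \<^term>\<open>weak_grad u\<close> is an arbitrary choice.  It is the fundamental lemma of the calculus of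
  variations, \<open>AE_eq_0_if_orthogonal_C1c\<close>.  Its proof avoids mollification: the sets \<open>{g \<noteq> 0}\<close> of
  test functions \<open>g\<close> form an intersection-stable generator of the Borel sets, and their indicators
  are bounded pointwise limits of test functions.\<close>

section \<open>Lebesgue measure under a linear bijection\<close>

lemma nn_integral_lborel_shift:
  fixes f :: "'a::euclidean_space \<Rightarrow> ennreal"
  assumes [measurable]: "f \<in> borel_measurable borel" and s: "\<bar>s\<bar> = 1"
  shows "(\<integral>\<^sup>+x. f (t + s *\<^sub>R x) \<partial>lborel) = (\<integral>\<^sup>+x. f x \<partial>lborel)"
proof -
  have "s \<noteq> 0" using s by auto
  show ?thesis
    by (subst (2) lborel_affine[OF \<open>s \<noteq> 0\<close>, of t])
       (simp add: nn_integral_density nn_integral_distr s)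
qed

text \<open>Both sides equal
  \<open>\<integral>\<integral> e x * f (x - A y) dx dy\<close>.  Integrating over \<open>y\<close> first, the substitution
  \<open>y \<mapsto> A\<^sup>-\<^sup>1 x - y\<close> turns \<open>x - A y\<close> into \<open>A y\<close>; integrating over \<open>x\<close> first, a
  translation by \<open>A y\<close> of \<open>x\<close> followed by one by \<open>A\<^sup>-\<^sup>1 x\<close> of \<open>y\<close> gives the other side.  Fixing \<open>e\<close> shows that
  \<open>f \<mapsto> \<integral> f \<circ> A\<close> is a constant multiple of the Lebesgue integral, by translation and reflection
  invariance alone.\<close>
lemma nn_integral_linear_exchange:
  fixes A :: "'a::euclidean_space \<Rightarrow> 'a" and e f :: "'a \<Rightarrow> ennreal"
  assumes A: "linear A" "inj A"
    and [measurable]: "e \<in> borel_measurable borel" "f \<in> borel_measurable borel"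
  shows "(\<integral>\<^sup>+x. e x \<partial>lborel) * (\<integral>\<^sup>+y. f (A y) \<partial>lborel)
       = (\<integral>\<^sup>+x. f x \<partial>lborel) * (\<integral>\<^sup>+y. e (A y) \<partial>lborel)"
proof -
  obtain A' where A': "linear A'" "\<And>x. A (A' x) = x"
    by (metis A linear_inj_imp_surj linear_surjective_right_inverse o_apply id_apply)
  have [measurable]: "A \<in> borel_measurable borel" "A' \<in> borel_measurable borel"
    using A A' by (auto intro!: borel_measurable_continuous_onI linear_continuous_on
        simp: linear_conv_bounded_linear)
  have "(\<integral>\<^sup>+x. e x \<partial>lborel) * (\<integral>\<^sup>+y. f (A y) \<partial>lborel)
      = (\<integral>\<^sup>+x. e x * (\<integral>\<^sup>+y. f (A y) \<partial>lborel) \<partial>lborel)"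
    by (simp add: nn_integral_multc)
  also have "\<dots> = (\<integral>\<^sup>+x. e x * (\<integral>\<^sup>+y. f (x - A y) \<partial>lborel) \<partial>lborel)"
  proof (rule nn_integral_cong, rule arg_cong2[where f="(*)", OF refl])
    fix x
    have "(\<integral>\<^sup>+y. f (A y) \<partial>lborel) = (\<integral>\<^sup>+y. f (A (A' x + (-1) *\<^sub>R y)) \<partial>lborel)"
      by (rule nn_integral_lborel_shift[symmetric]) auto
    also have "\<dots> = (\<integral>\<^sup>+y. f (x - A y) \<partial>lborel)"
      using A A' by (simp add: linear_diff)
    finally show "(\<integral>\<^sup>+y. f (A y) \<partial>lborel) = (\<integral>\<^sup>+y. f (x - A y) \<partial>lborel)" .
  qed
  also have "\<dots> = (\<integral>\<^sup>+x. \<integral>\<^sup>+y. e x * f (x - A y) \<partial>lborel \<partial>lborel)"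
    by (simp add: nn_integral_cmult)
  also have "\<dots> = (\<integral>\<^sup>+y. \<integral>\<^sup>+x. e x * f (x - A y) \<partial>lborel \<partial>lborel)"
    by (rule lborel_pair.Fubini'[symmetric]) measurable
  also have "\<dots> = (\<integral>\<^sup>+y. \<integral>\<^sup>+x. e (A y + x) * f x \<partial>lborel \<partial>lborel)"
  proof (rule nn_integral_cong)
    fix y
    show "(\<integral>\<^sup>+x. e x * f (x - A y) \<partial>lborel) = (\<integral>\<^sup>+x. e (A y + x) * f x \<partial>lborel)"
      using nn_integral_lborel_shift[of "\<lambda>x. e x * f (x - A y)" 1 "A y"] by simp
  qed
  also have "\<dots> = (\<integral>\<^sup>+x. \<integral>\<^sup>+y. e (A y + x) * f x \<partial>lborel \<partial>lborel)"
    by (rule lborel_pair.Fubini') measurable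
  also have "\<dots> = (\<integral>\<^sup>+x. (\<integral>\<^sup>+y. e (A y + x) \<partial>lborel) * f x \<partial>lborel)"
    by (simp add: nn_integral_multc)
  also have "\<dots> = (\<integral>\<^sup>+x. (\<integral>\<^sup>+y. e (A y) \<partial>lborel) * f x \<partial>lborel)"
  proof (rule nn_integral_cong, rule arg_cong2[where f="(*)", OF _ refl])
    fix x
    have "(\<integral>\<^sup>+y. e (A y) \<partial>lborel) = (\<integral>\<^sup>+y. e (A (A' x + 1 *\<^sub>R y)) \<partial>lborel)"
      by (rule nn_integral_lborel_shift[symmetric]) auto
    also have "\<dots> = (\<integral>\<^sup>+y. e (A y + x) \<partial>lborel)"
      using A A' by (simp add: linear_add add.commute)
    finally show "(\<integral>\<^sup>+y. e (A y + x) \<partial>lborel) = (\<integral>\<^sup>+y. e (A y) \<partial>lborel)" ..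
  qed
  also have "\<dots> = (\<integral>\<^sup>+x. f x \<partial>lborel) * (\<integral>\<^sup>+y. e (A y) \<partial>lborel)"
    by (simp add: nn_integral_cmult mult.commute[of "\<integral>\<^sup>+y. e (A y) \<partial>lborel"])
       (simp add: nn_integral_multc)
  finally show ?thesis .
qed

text \<open>The previous lemma is applied with \<open>e\<close> the indicator of the unit ball:
  the ball and its preimage under \<open>A\<close> are bounded and have nonempty interior, so both measures are
  finite and positive, and their quotient is the constant (which is \<open>\<bar>det A\<bar>\<close>).\<close>
lemma lborel_eq_density_linear:
  fixes A :: "'a::euclidean_space \<Rightarrow> 'a"
  assumes A: "linear A" "inj A"
  obtains c :: real where "c > 0" "lborel = density (distr lborel borel A) (\<lambda>_. ennreal c)"
proof -
  have cA: "continuous_on UNIV A"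
    using A by (auto intro!: linear_continuous_on simp: linear_conv_bounded_linear)
  then have [measurable]: "A \<in> borel_measurable borel"
    by (rule borel_measurable_continuous_onI)
  let ?U = "ball (0::'a) 1" let ?V = "A -` ball 0 1"
  have "open ?V" using cA by (simp add: open_vimage)
  have "0 \<in> ?V" using A by (simp add: linear_0)
  then have "?V \<noteq> {}" by blast
  obtain A' where A': "linear A'" "A' \<circ> A = id"
    using A linear_injective_left_inverse by blast
  have "bounded (A' ` ?U)"
    using A' by (intro bounded_linear_image) (auto simp: linear_conv_bounded_linear)
  moreover have "?V \<subseteq> A' ` ?U"
  proof
    fix x assume "x \<in> ?V"
    moreover have "x = A' (A x)" using A' by (simp add: o_def id_def fun_eq_iff)
    ultimately show "x \<in> A' ` ?U" by blast
  qed
  ultimately have "bounded ?V" by (rule bounded_subset)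
  have V: "emeasure lborel ?V < \<infinity>" using \<open>bounded ?V\<close> by (rule emeasure_bounded_finite)
  have V0: "emeasure lborel ?V \<noteq> 0"
    using open_not_negligible[OF \<open>open ?V\<close> \<open>?V \<noteq> {}\<close>] \<open>open ?V\<close>
    by (simp add: negligible_iff_null_sets null_sets_def)
  have U: "emeasure lborel ?U < \<infinity>" by (rule emeasure_bounded_finite) auto
  have U0: "emeasure lborel ?U \<noteq> 0"
    using open_not_negligible[of ?U] unfolding negligible_iff_null_sets 
    by (auto simp: null_sets_def null_sets_completion_iff)
  define a where "a = measure lborel ?U" define b where "b = measure lborel ?V"
  have a: "emeasure lborel ?U = ennreal a" "a > 0"
    using U U0 unfolding a_def by (auto simp: emeasure_eq_ennreal_measure less_top zero_less_measure_iff)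
  have b: "emeasure lborel ?V = ennreal b" "b > 0"
    using V V0 unfolding b_def by (auto simp: emeasure_eq_ennreal_measure less_top zero_less_measure_iff)
  \<comment> \<open>The exchange identity for the indicators of the unit ball and of an arbitrary Borel set.\<close>
  have "emeasure (distr lborel borel A) F * ennreal a = emeasure lborel F * ennreal b"
    if [measurable]: "F \<in> sets borel" for F
  proof -
    have "ennreal a = (\<integral>\<^sup>+x. indicator ?U x \<partial>lborel)" using a by simp
    moreover have "ennreal b = (\<integral>\<^sup>+x. indicator ?U (A x) \<partial>lborel)"
    proof -
      have "(\<integral>\<^sup>+x. indicator ?U (A x) \<partial>lborel) = (\<integral>\<^sup>+x. indicator ?V x \<partial>lborel)"
        by (intro nn_integral_cong) (auto simp: indicator_def)
      then show ?thesis using b \<open>open ?V\<close> by simp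
    qed
    moreover have "emeasure (distr lborel borel A) F = (\<integral>\<^sup>+x. indicator F (A x) \<partial>lborel)"
      using nn_integral_distr[of A lborel borel "indicator F"] by simp
    ultimately show ?thesis
      using nn_integral_linear_exchange[OF A, of "indicator ?U" "indicator F"] a(1)
      by (simp add: mult.commute borel_measurable_indicator)
  qed note key = this
  have "lborel = density (distr lborel borel A) (\<lambda>_. ennreal (a / b))"
  proof (rule measure_eqI)
    fix F :: "'a set" assume "F \<in> sets lborel"
    then have F[measurable]: "F \<in> sets borel" by simp
    have "emeasure (density (distr lborel borel A) (\<lambda>_. ennreal (a / b))) F
        = ennreal (a / b) * emeasure (distr lborel borel A) F"
      by (simp add: emeasure_density nn_integral_cmult)
    also have "\<dots> = ennreal (1 / b) * (emeasure (distr lborel borel A) F * ennreal a)"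
      using a b by (simp add: mult_ac ennreal_mult[symmetric])
        (simp add: mult.assoc[symmetric] ennreal_mult[symmetric])
    also have "\<dots> = ennreal (1/b) * ennreal b * emeasure lborel F"
      using key[OF F] by (simp add: mult_ac)
    also have "\<dots> = emeasure lborel F" using b by (simp add: ennreal_mult[symmetric])
    finally show "emeasure lborel F = emeasure (density (distr lborel borel A) (\<lambda>_. ennreal (a / b))) F" ..
  qed simp
  moreover have "a / b > 0" using a b by simp
  ultimately show thesis by (rule that[rotated])
qed

text \<open>Completion respects the identity for Borel sets because \<open>A\<close> preserves
  Borel null sets in both directions.\<close>
lemma lebesgue_eq_density_linear:
  fixes A :: "'a::euclidean_space \<Rightarrow> 'a"
  assumes A: "linear A" "inj A"
  obtains c :: real where "c > 0" "A \<in> lebesgue \<rightarrow>\<^sub>M lebesgue"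
    "lebesgue = density (distr lebesgue lebesgue A) (\<lambda>_. ennreal c)"
proof -
  obtain c :: real where c: "c > 0" "lborel = density (distr lborel borel A) (\<lambda>_. ennreal c)"
    using lborel_eq_density_linear[OF A] .
  have [measurable]: "A \<in> borel_measurable borel"
    using A by (auto intro!: borel_measurable_continuous_onI linear_continuous_on
        simp: linear_conv_bounded_linear)
  have "emeasure lborel E = 0 \<longleftrightarrow> emeasure (distr lebesgue lborel A) E = 0" if E: "E \<in> sets borel" for E
  proof -
    have "emeasure lborel E = emeasure (density (distr lborel borel A) (\<lambda>_. ennreal c)) E"
      using c by simp
    also have "\<dots> = ennreal c * emeasure (distr lborel borel A) E"
      using E by (simp add: emeasure_density nn_integral_cmult)
    also have "distr lborel borel A = distr lebesgue lborel A"
      by (simp add: distr_completion cong: distr_cong)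
    finally show ?thesis using c by simp
  qed
  then have eq: "null_sets lborel = null_sets (distr lebesgue lborel A)"
    by (auto simp: null_sets_def)
  have meas: "A \<in> lebesgue \<rightarrow>\<^sub>M lebesgue"
    by (simp add: completion.measurable_completion2 eq measurable_completion)
  have "lebesgue = completion (density (distr lborel borel A) (\<lambda>_. ennreal c))"
    using c by simp
  also have "\<dots> = density (completion (distr lebesgue lborel A)) (\<lambda>_. ennreal c)"
    using c(1) by (auto intro!: always_eventually completion_density_eq simp: distr_completion cong: distr_cong)
  also have "\<dots> = density (distr lebesgue lebesgue A) (\<lambda>_. ennreal c)"
    by (subst completion.completion_distr_eq) (auto simp: eq measurable_completion)
  finally show thesis using that c meas by blast
qed

lemma measurable_lebesgue_linear:
  fixes A :: "'a::euclidean_space \<Rightarrow> 'a"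
  assumes "linear A" "inj A"
  shows "A \<in> lebesgue \<rightarrow>\<^sub>M lebesgue"
  using lebesgue_eq_density_linear[OF assms] by blast

lemma integrable_lebesgue_linear:
  fixes A :: "'a::euclidean_space \<Rightarrow> 'a" and f :: "'a \<Rightarrow> 'b::{banach,second_countable_topology}"
  assumes A: "linear A" "inj A" and f: "integrable lebesgue f"
  shows "integrable lebesgue (\<lambda>x. f (A x))"
proof -
  obtain c :: real where c: "c > 0" and m[measurable]: "A \<in> lebesgue \<rightarrow>\<^sub>M lebesgue"
    and eq: "lebesgue = density (distr lebesgue lebesgue A) (\<lambda>_. ennreal c)"
    using lebesgue_eq_density_linear[OF A] .
  have [measurable]: "f \<in> borel_measurable lebesgue" using f by auto
  have "integrable (distr lebesgue lebesgue A) (\<lambda>x. c *\<^sub>R f x)"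
    using f c by (subst (asm) eq) (simp add: integrable_density)
  then have "integrable (distr lebesgue lebesgue A) f"
    using c integrable_scaleR_right[of "1 / c" _ "\<lambda>x. c *\<^sub>R f x"] by simp
  then show ?thesis by (simp add: integrable_distr_eq)
qed

text \<open>The constant is left unspecified: in every application it occurs on
  both sides of an equation and cancels.\<close>
lemma integral_lebesgue_linear:
  fixes A :: "'a::euclidean_space \<Rightarrow> 'a"
  assumes A: "linear A" "inj A"
  obtains c :: real where "c > 0"
    "\<And>f::'a \<Rightarrow> 'b::{banach,second_countable_topology}. f \<in> borel_measurable lebesgue \<Longrightarrow>
        (\<integral>x. f x \<partial>lebesgue) = c *\<^sub>R (\<integral>x. f (A x) \<partial>lebesgue)"
proof -
  obtain c :: real where c: "c > 0" and m[measurable]: "A \<in> lebesgue \<rightarrow>\<^sub>M lebesgue"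
    and eq: "lebesgue = density (distr lebesgue lebesgue A) (\<lambda>_. ennreal c)"
    using lebesgue_eq_density_linear[OF A] .
  have "(\<integral>x. f x \<partial>lebesgue) = c *\<^sub>R (\<integral>x. f (A x) \<partial>lebesgue)"
    if [measurable]: "f \<in> borel_measurable lebesgue" for f :: "'a \<Rightarrow> 'b"
    using c by (subst eq) (simp add: integral_density integral_distr)
  then show thesis using that c by blast
qed

section \<open>Compactly supported \<open>C\<^sup>1\<close> functions\<close>

lemma grad_eqI:
  fixes f :: "real^'n \<Rightarrow> real"
  assumes "(f has_derivative (\<lambda>h. v \<bullet> h)) (at x)"
  shows "grad f x = v"
proof -
  have "deriv (\<lambda>t. f (x + t *\<^sub>R axis i 1)) 0 = v $ i" for i
  proof (rule DERIV_imp_deriv)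
    have "((\<lambda>t. f (x + t *\<^sub>R axis i 1)) has_derivative (\<lambda>h. v \<bullet> (h *\<^sub>R axis i 1))) (at 0)"
      by (rule has_derivative_compose[of "\<lambda>t. x + t *\<^sub>R axis i 1" _ _ _ f])
         (use assms in \<open>auto intro!: derivative_eq_intros\<close>)
    then show "((\<lambda>t. f (x + t *\<^sub>R axis i 1)) has_field_derivative v $ i) (at 0)"
      by (rule has_derivative_imp_has_field_derivative) (simp add: inner_axis)
  qed
  then show ?thesis by (simp add: grad_def vec_eq_iff)
qed

lemma has_derivative_grad:
  fixes f :: "real^'n \<Rightarrow> real"
  assumes "f differentiable (at x)"
  shows "(f has_derivative (\<lambda>h. grad f x \<bullet> h)) (at x)"
proof -
  obtain D where D: "(f has_derivative D) (at x)" using assms by (auto simp: differentiable_def)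
  then have "linear D" by (rule has_derivative_linear)
  then have "D = (\<lambda>h. (\<chi> i. D (axis i 1)) \<bullet> h)"
  proof (intro ext)
    fix h :: "real^'n"
    have "D h = D (\<Sum>i\<in>UNIV. h $ i *\<^sub>R axis i 1)"
      by (simp add: basis_expansion[of h, unfolded scalar_mult_eq_scaleR])
    also have "\<dots> = (\<Sum>i\<in>UNIV. h $ i * D (axis i 1))"
      using \<open>linear D\<close> by (simp add: linear_sum linear_cmul)
    also have "\<dots> = (\<chi> i. D (axis i 1)) \<bullet> h" by (simp add: inner_vec_def mult.commute)
    finally show "D h = (\<chi> i. D (axis i 1)) \<bullet> h" .
  qed
  with D show ?thesis using grad_eqI by metis
qed

text \<open>The predicate is stated through partial derivatives; this rule and the next
  lemma pass between it and total derivatives, so that closure properties follow from the calculus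
  of total derivatives.\<close>
lemma C1cI:
  fixes f :: "real^'n \<Rightarrow> real"
  assumes D: "\<And>x. (f has_derivative (\<lambda>h. G x \<bullet> h)) (at x)"
    and G: "continuous_on UNIV G" and K: "compact K" "\<And>x. x \<notin> K \<Longrightarrow> f x = 0"
  shows "f \<in> C1c"
proof -
  have "grad f = G" using grad_eqI[OF D] by auto
  moreover have "closure {x. f x \<noteq> 0} \<subseteq> K"
    by (rule closure_minimal) (use K compact_imp_closed in blast)+
  then have "compact (closure {x. f x \<noteq> 0})"
    using compact_Int_closed[OF K(1) closed_closure, of "{x. f x \<noteq> 0}"]
    by (simp add: Int_absorb1 del: compact_closure)
  ultimately show ?thesis using D G by (auto simp: C1c_def differentiable_def)
qed

lemma C1cD:
  fixes f :: "real^'n \<Rightarrow> real"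
  assumes "f \<in> C1c"
  shows "(f has_derivative (\<lambda>h. grad f x \<bullet> h)) (at x)"
    and "continuous_on UNIV (grad f)" "continuous_on UNIV f"
proof -
  show *: "(f has_derivative (\<lambda>h. grad f x \<bullet> h)) (at x)" for x
    using assms by (auto simp: C1c_def intro: has_derivative_grad)
  show "continuous_on UNIV (grad f)" using assms by (simp add: C1c_def)
  show "continuous_on UNIV f" 
    by (intro continuous_at_imp_continuous_on ballI has_derivative_continuous[OF *])
qed

lemma zero_outside_support:
  assumes "x \<notin> closure {x. f x \<noteq> 0}" shows "f x = 0"
proof (rule ccontr)
  assume "f x \<noteq> 0"
  then have "x \<in> {x. f x \<noteq> 0}" by blast
  then have "x \<in> closure {x. f x \<noteq> 0}" by (rule subsetD[OF closure_subset])
  with assms show False by contradiction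
qed

lemma C1c_support:
  fixes f :: "real^'n \<Rightarrow> real"
  assumes "f \<in> C1c"
  obtains K C where "compact K" "C \<ge> 0"
    "\<And>x. \<bar>f x\<bar> \<le> C * indicator K x" "\<And>x. norm (grad f x) \<le> C * indicator K x"
proof -
  define K where "K = closure {x. f x \<noteq> 0}"
  have K: "compact K" using assms by (simp add: C1c_def K_def)
  have f0: "f x = 0" if "x \<notin> K" for x using zero_outside_support[of x f] that unfolding K_def by blast
  have g0: "grad f x = 0" if "x \<notin> K" for x
  proof (rule grad_eqI)
    have "((\<lambda>_. 0) has_derivative (\<lambda>h. 0 \<bullet> h)) (at x)" by simp
    then show "(f has_derivative (\<lambda>h. 0 \<bullet> h)) (at x)"
      by (rule has_derivative_transform_within_open[where s="- K"]) (use that f0 K compact_imp_closed in auto)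
  qed
  have "bounded (f ` K)" "bounded (grad f ` K)"
    using K C1cD[OF assms] by (auto intro!: compact_imp_bounded compact_continuous_image intro: continuous_on_subset)
  then obtain a b where a: "\<And>x. x \<in> K \<Longrightarrow> \<bar>f x\<bar> \<le> a" and b: "\<And>x. x \<in> K \<Longrightarrow> norm (grad f x) \<le> b"
    unfolding bounded_iff by (metis imageI real_norm_def)
  let ?C = "max 0 (max a b)"
  show thesis
  proof (rule that[of K ?C])
    show "\<bar>f x\<bar> \<le> ?C * indicator K x" for x
      using a[of x] f0[of x] by (cases "x \<in> K") auto
    show "norm (grad f x) \<le> ?C * indicator K x" for x
      using b[of x] g0[of x] by (cases "x \<in> K") auto
  qed (use K in auto)
qed

lemma C1c_measurable:
  assumes "f \<in> C1c"
  shows "f \<in> borel_measurable lebesgue" "grad f \<in> borel_measurable lebesgue"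
  using borel_measurable_continuous_onI[OF C1cD(3)[OF assms]]
    borel_measurable_continuous_onI[OF C1cD(2)[OF assms]]
  by (auto intro: measurable_completion)

lemma C1c_mult:
  assumes f: "f \<in> C1c" and g: "g \<in> C1c"
  shows "(\<lambda>x. f x * g x) \<in> C1c"
proof (rule C1cI)
  show "((\<lambda>x. f x * g x) has_derivative (\<lambda>h. (f x *\<^sub>R grad g x + g x *\<^sub>R grad f x) \<bullet> h)) (at x)" for x
    by (rule has_derivative_eq_rhs[OF has_derivative_mult[OF C1cD(1)[OF f] C1cD(1)[OF g]]])
       (simp add: inner_add_left fun_eq_iff)
  show "continuous_on UNIV (\<lambda>x. f x *\<^sub>R grad g x + g x *\<^sub>R grad f x)"
    using C1cD[OF f] C1cD[OF g] by (intro continuous_intros)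
  show "compact (closure {x. f x \<noteq> 0})" using f by (simp add: C1c_def)
  show "f x * g x = 0" if "x \<notin> closure {x. f x \<noteq> 0}" for x
    using zero_outside_support[OF that] by simp
qed

text \<open>The condition \<open>h 0 = 0\<close> keeps the support compact.\<close>
lemma C1c_compose:
  assumes f: "f \<in> C1c" and h: "\<And>t. (h has_real_derivative h' t) (at t)" "continuous_on UNIV h'" "h 0 = 0"
  shows "(\<lambda>x. h (f x)) \<in> C1c"
proof (rule C1cI)
  show "((\<lambda>x. h (f x)) has_derivative (\<lambda>v. (h' (f x) *\<^sub>R grad f x) \<bullet> v)) (at x)" for x
    using has_derivative_compose[OF C1cD(1)[OF f] h(1)[unfolded has_field_derivative_def]]
    by simp
  show "continuous_on UNIV (\<lambda>x. h' (f x) *\<^sub>R grad f x)"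
    using C1cD[OF f] h(2) by (auto intro!: continuous_intros continuous_on_compose2[of UNIV h' UNIV f])
  show "compact (closure {x. f x \<noteq> 0})" using f by (simp add: C1c_def)
  show "h (f x) = 0" if "x \<notin> closure {x. f x \<noteq> 0}" for x
    using zero_outside_support[OF that] h(3) by simp
qed

lemma C1c_linear:
  fixes A :: "real^'n^'n"
  assumes f: "f \<in> C1c" and A: "invertible A"
  shows "(\<lambda>x. f (A *v x)) \<in> C1c" "grad (\<lambda>x. f (A *v x)) x = transpose A *v grad f (A *v x)"
proof -
  have D: "((\<lambda>x. f (A *v x)) has_derivative (\<lambda>h. (transpose A *v grad f (A *v x)) \<bullet> h)) (at x)" for x
  proof -
    have "((\<lambda>x. A *v x) has_derivative (\<lambda>h. A *v h)) (at x)"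
      by (intro bounded_linear_imp_has_derivative) simp
    from has_derivative_compose[OF this C1cD(1)[OF f]] show ?thesis
      by (simp add: dot_lmul_matrix vector_transpose_matrix)
  qed
  from grad_eqI[OF this] show "grad (\<lambda>x. f (A *v x)) x = transpose A *v grad f (A *v x)" .
  let ?K = "closure {x. f x \<noteq> 0}"
  obtain A' where A': "A' ** A = mat 1" using A by (auto simp: invertible_def)
  show "(\<lambda>x. f (A *v x)) \<in> C1c"
  proof (rule C1cI[OF D])
    have cA: "continuous_on X ((*v) B)" for X and B :: "real^'n^'n"
      by (intro linear_continuous_on) simp
    show "continuous_on UNIV (\<lambda>x. transpose A *v grad f (A *v x))"
      by (intro continuous_on_compose2[OF cA[of UNIV]] continuous_on_compose2[OF C1cD(2)[OF f]] cA) auto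
    show "compact ((*v) A' ` ?K)"
      using f by (intro compact_continuous_image cA) (simp add: C1c_def)
    show "f (A *v x) = 0" if x: "x \<notin> (*v) A' ` ?K" for x
    proof (rule ccontr)
      assume "f (A *v x) \<noteq> 0"
      then have "A *v x \<in> ?K" using zero_outside_support[of "A *v x" f] by blast
      moreover have "A' *v (A *v x) = x" by (simp add: matrix_vector_mul_assoc A')
      ultimately show False using x by (metis imageI)
    qed
  qed
qed

lemma DERIV_max_0_square: "((\<lambda>t. (max 0 t)\<^sup>2) has_real_derivative 2 * max 0 t) (at t)"
proof -
  consider "t > 0" | "t < 0" | "t = 0" by linarith
  then show ?thesis
  proof cases
    case 1
    have "((\<lambda>t. t\<^sup>2) has_real_derivative 2 * t) (at t)" by (auto intro!: derivative_eq_intros)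
    then have "((\<lambda>t. (max 0 t)\<^sup>2) has_real_derivative 2 * t) (at t)"
      by (rule has_field_derivative_transform_within_open[where S="{0<..}"]) (use 1 in auto)
    then show ?thesis using 1 by simp
  next
    case 2
    have "((\<lambda>t. 0) has_real_derivative 0) (at t)" by simp
    then have "((\<lambda>t. (max 0 t)\<^sup>2) has_real_derivative 0) (at t)"
      by (rule has_field_derivative_transform_within_open[where S="{..<0}"]) (use 2 in auto)
    then show ?thesis using 2 by simp
  next
    case 3
    have "(\<lambda>h::real. (max 0 h)\<^sup>2 / h) \<midarrow>0\<rightarrow> 0"
    proof (rule Lim_null_comparison)
      show "\<forall>\<^sub>F h in at (0::real). norm ((max 0 h)\<^sup>2 / h) \<le> \<bar>h\<bar>"
        by (intro always_eventually) (auto simp: max_def power2_eq_square)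
      show "((\<lambda>h::real. \<bar>h\<bar>) \<longlongrightarrow> 0) (at 0)" by (auto intro!: tendsto_eq_intros)
    qed
    then show ?thesis using 3 by (simp add: DERIV_def)
  qed
qed

text \<open>The squared positive part of \<open>r\<^sup>2 - |x - a|\<^sup>2\<close> is once continuously
  differentiable, because \<open>t \<mapsto> (max 0 t)\<^sup>2\<close> is.\<close>
lemma ball_eq_C1c_support:
  fixes a :: "real^'n"
  obtains g where "g \<in> C1c" "{x. g x \<noteq> 0} = ball a r"
proof (cases "r > 0")
  case True
  let ?q = "\<lambda>x. r\<^sup>2 - (x - a) \<bullet> (x - a)" let ?g = "\<lambda>x. (max 0 (?q x))\<^sup>2"
  have iff: "?q x > 0 \<longleftrightarrow> x \<in> ball a r" for x
  proof -
    have "(x - a) \<bullet> (x - a) = (dist a x)\<^sup>2"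
      by (simp add: dot_square_norm dist_norm norm_minus_commute)
    moreover have "r\<^sup>2 \<le> (dist a x)\<^sup>2 \<longleftrightarrow> r \<le> dist a x"
      using True by (intro power_mono_iff) auto
    ultimately show ?thesis by auto
  qed
  have "?g \<in> C1c"
  proof (rule C1cI)
    show "(?g has_derivative (\<lambda>h. ((- 4 * max 0 (?q x)) *\<^sub>R (x - a)) \<bullet> h)) (at x)" for x
    proof -
      have "(?q has_derivative (\<lambda>h. - 2 * ((x - a) \<bullet> h))) (at x)"
        by (auto intro!: derivative_eq_intros simp: inner_commute)
      from has_derivative_compose[OF this DERIV_max_0_square[unfolded has_field_derivative_def]]
      show ?thesis by (simp add: algebra_simps)
    qed
    show "continuous_on UNIV (\<lambda>x. (- 4 * max 0 (?q x)) *\<^sub>R (x - a))"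
      by (intro continuous_intros)
    show "compact (cball a r)" by simp
    show "?g x = 0" if "x \<notin> cball a r" for x
    proof -
      have "x \<notin> ball a r" using that by auto
      then show ?thesis using iff[of x] by simp
    qed
  qed
  moreover have "{x. ?g x \<noteq> 0} = ball a r"
  proof -
    have "?g x \<noteq> 0 \<longleftrightarrow> ?q x > 0" for x by (cases "?q x > 0") auto
    then show ?thesis using iff by blast
  qed
  ultimately show thesis by (rule that)
next
  case False
  have "(\<lambda>x. 0) \<in> C1c" by (rule C1cI[where G="\<lambda>_. 0" and K="{}"]) auto
  then show thesis using False by (intro that[of "\<lambda>x. 0"]) (auto simp: ball_empty)
qed

section \<open>The fundamental lemma of the calculus of variations\<close>

text \<open>Balls are such sets, and every open set is a countable union of balls.  The
  generator consists of all these sets, and not only of the balls, because it is then closed under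
  intersection: the product of two test functions is a test function.\<close>
lemma borel_sigma_C1c_supports:
  "sets (borel :: (real^'n) measure) \<subseteq> sigma_sets UNIV {{x. g x \<noteq> 0} | g. g \<in> C1c}"
    (is "_ \<subseteq> sigma_sets UNIV ?E")
proof -
  have "S \<in> sigma_sets UNIV ?E" if "open S" for S :: "(real^'n) set"
  proof -
    define \<B> where "\<B> = {ball a r | a r. ball a r \<subseteq> S}"
    have "\<Union>\<B> = S"
    proof
      show "S \<subseteq> \<Union>\<B>"
      proof
        fix x assume "x \<in> S"
        then obtain e where "e > 0" "ball x e \<subseteq> S" using \<open>open S\<close> openE by blast
        then show "x \<in> \<Union>\<B>" unfolding \<B>_def using centre_in_ball[of x e] by blast
      qed
    qed (auto simp: \<B>_def)
    moreover obtain \<C> where \<C>: "\<C> \<subseteq> \<B>" "countable \<C>" "\<Union>\<C> = \<Union>\<B>"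
      using Lindelof[of \<B>] unfolding \<B>_def by blast
    moreover have \<B>: "\<B> \<subseteq> sigma_sets UNIV ?E"
    proof
      fix b assume "b \<in> \<B>"
      then obtain a r where "b = ball a r" by (auto simp: \<B>_def)
      moreover obtain g where "g \<in> C1c" "{x. g x \<noteq> 0} = ball a r" by (rule ball_eq_C1c_support)
      ultimately show "b \<in> sigma_sets UNIV ?E" by (intro sigma_sets.Basic) blast
    qed
    moreover have "\<Union>\<C> \<in> sigma_sets UNIV ?E"
      by (rule sigma_sets_UNION[OF \<C>(2)]) (use \<C>(1) \<B> in blast)
    ultimately show ?thesis by simp
  qed
  then have "{S. open S} \<subseteq> sigma_sets UNIV ?E" by blast
  then have "sigma_sets UNIV {S. open S} \<subseteq> sigma_sets UNIV ?E" by (rule sigma_sets_mono)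
  then show ?thesis by (simp add: borel_def sets_measure_of)
qed

text \<open>The indicator of \<open>{g \<noteq> 0}\<close> is the pointwise limit of the test functions
  \<open>k g\<^sup>2 / (1 + k g\<^sup>2)\<close>, which take values in \<open>[0,1]\<close>, so dominated convergence applies.  The square
  makes the outer function continuously differentiable on the whole line, whatever the sign of
  \<open>g\<close>.\<close>
lemma set_integral_C1c_support_eq_0:
  fixes f :: "real^'n \<Rightarrow> 'b::{banach, second_countable_topology}"
  assumes f: "integrable lebesgue f"
    and orth: "\<And>\<phi>. \<phi> \<in> C1c \<Longrightarrow> (\<integral>x. \<phi> x *\<^sub>R f x \<partial>lebesgue) = 0"
    and g: "g \<in> C1c"
  shows "(\<integral>x. indicator {x. g x \<noteq> 0} x *\<^sub>R f x \<partial>lebesgue) = 0"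
proof -
  define h where "h = (\<lambda>k t. real k * t\<^sup>2 / (1 + real k * t\<^sup>2))"
  have pos: "1 + real k * t\<^sup>2 > 0" for k t by (simp add: add_pos_nonneg)
  have h_bound: "\<bar>h k t\<bar> \<le> 1" for k t using pos[of k t] by (simp add: h_def)
  have h_lim: "(\<lambda>k. h k t) \<longlonglongrightarrow> (if t \<noteq> 0 then 1 else 0)" for t
  proof (cases "t = 0")
    case False
    have "filterlim (\<lambda>k. 1 + real k * t\<^sup>2) at_top sequentially"
      using False by (intro filterlim_tendsto_add_at_top[OF tendsto_const]
          filterlim_at_top_mult_tendsto_pos[OF tendsto_const] filterlim_real_sequentially) auto
    then have "(\<lambda>k. 1 - 1 / (1 + real k * t\<^sup>2)) \<longlonglongrightarrow> 1 - 0"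
      by (intro tendsto_diff tendsto_const tendsto_divide_0[OF tendsto_const] filterlim_at_top_imp_at_infinity)
    moreover have "h k t = 1 - 1 / (1 + real k * t\<^sup>2)" for k
      using pos[of k t] by (simp add: h_def field_simps)
    ultimately show ?thesis using False by simp
  qed (simp add: h_def)
  have hC: "(\<lambda>x. h k (g x)) \<in> C1c" for k
  proof (rule C1c_compose[OF g])
    show "(h k has_real_derivative 2 * real k * t / (1 + real k * t\<^sup>2)\<^sup>2) (at t)" for t
      unfolding h_def using pos[of k t]
      by (auto intro!: derivative_eq_intros simp: power2_eq_square) (simp add: field_simps)
    show "continuous_on UNIV (\<lambda>t. 2 * real k * t / (1 + real k * t\<^sup>2)\<^sup>2)"
      using pos[of k] by (intro continuous_intros) (auto simp: less_le)
    show "h k 0 = 0" by (simp add: h_def)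
  qed
  have [measurable]: "f \<in> borel_measurable lebesgue" using f by auto
  have [measurable]: "(\<lambda>x. h k (g x)) \<in> borel_measurable lebesgue" for k
    using C1c_measurable(1)[OF hC] .
  have [measurable]: "g \<in> borel_measurable lebesgue" using C1c_measurable(1)[OF g] .
  have "(\<lambda>k. \<integral>x. h k (g x) *\<^sub>R f x \<partial>lebesgue)
      \<longlonglongrightarrow> (\<integral>x. indicator {x. g x \<noteq> 0} x *\<^sub>R f x \<partial>lebesgue)"
  proof (rule integral_dominated_convergence)
    show "integrable lebesgue (\<lambda>x. norm (f x))" using f by simp
    show "AE x in lebesgue. (\<lambda>k. h k (g x) *\<^sub>R f x) \<longlonglongrightarrow> indicator {x. g x \<noteq> 0} x *\<^sub>R f x"
    proof (intro AE_I2 tendsto_scaleR tendsto_const)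
      show "(\<lambda>k. h k (g x)) \<longlonglongrightarrow> indicator {x. g x \<noteq> 0} x" for x
        using h_lim[of "g x"] by (cases "g x = 0") (simp_all add: indicator_def)
    qed
    show "AE x in lebesgue. norm (h k (g x) *\<^sub>R f x) \<le> norm (f x)" for k
      using h_bound by (auto intro!: AE_I2 mult_left_le_one_le)
  qed measurable
  then show ?thesis using orth[OF hC] by (simp add: LIMSEQ_const_iff)
qed

lemma sigma_finite_lebesgue: "sigma_finite_measure (lebesgue :: 'a::euclidean_space measure)"
proof
  obtain F :: "'a set set" where F: "countable F" "F \<subseteq> sets lborel" "\<Union>F = space lborel"
    "\<forall>a\<in>F. emeasure lborel a \<noteq> \<infinity>"
    using lborel.sigma_finite_countable by blast
  then show "\<exists>F. countable F \<and> F \<subseteq> sets (lebesgue :: 'a measure) \<and> \<Union>F = space lebesgue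
      \<and> (\<forall>a\<in>F. emeasure lebesgue a \<noteq> \<infinity>)"
    by (intro exI[of _ F]) auto
qed

text \<open>The sets over which \<open>f\<close> integrates to zero contain the intersection-stable
  generator above and are closed under countable disjoint unions; they are closed under complements because
  the total integral vanishes.  Hence they include all Borel sets and, up to null sets, all Lebesgue
  sets.\<close>
lemma AE_eq_0_if_integrable_orthogonal_C1c:
  fixes f :: "real^'n \<Rightarrow> 'b::{banach, second_countable_topology}"
  assumes f: "integrable lebesgue f" and f0: "(\<integral>x. f x \<partial>lebesgue) = 0"
    and orth: "\<And>\<phi>. \<phi> \<in> C1c \<Longrightarrow> (\<integral>x. \<phi> x *\<^sub>R f x \<partial>lebesgue) = 0"
  shows "AE x in lebesgue. f x = 0"
proof (rule sigma_finite_measure.density_zero[OF sigma_finite_lebesgue f])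
  let ?E = "{{x. g x \<noteq> 0} | g :: real^'n \<Rightarrow> real. g \<in> C1c}"
  have E: "?E \<subseteq> sets borel"
  proof
    fix A assume "A \<in> ?E"
    then obtain g where g: "g \<in> C1c" "A = {x. g x \<noteq> 0}" by auto
    have "open (g -` (- {0}))"
      using C1cD(3)[OF g(1)] by (intro open_vimage) auto
    moreover have "g -` (- {0}) = A" using g by auto
    ultimately show "A \<in> sets borel" by auto
  qed
  have si: "set_integrable lebesgue A f" if "A \<in> sets borel" for A
    using that integrable_mult_indicator[OF _ f] by (simp add: set_integrable_def)
  have borel: "set_lebesgue_integral lebesgue A f = 0" if "A \<in> sets borel" for A
  proof -
    have "Int_stable ?E"
    proof (rule Int_stableI)
      fix a b assume "a \<in> ?E" "b \<in> ?E"
      then obtain g h where "g \<in> C1c" "a = {x. g x \<noteq> 0}" "h \<in> C1c" "b = {x. h x \<noteq> 0}" by auto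
      then show "a \<inter> b \<in> ?E"
        by (intro CollectI exI[of _ "\<lambda>x. g x * h x"]) (auto intro: C1c_mult)
    qed
    moreover have "?E \<subseteq> Pow UNIV" by simp
    moreover have "A \<in> sigma_sets UNIV ?E" using that borel_sigma_C1c_supports by blast
    ultimately show ?thesis
    proof (induction rule: sigma_sets_induct_disjoint)
      case (basic A)
      then show ?case
        using set_integral_C1c_support_eq_0[OF f orth] by (auto simp: set_lebesgue_integral_def)
    next
      case empty
      then show ?case by (simp add: set_lebesgue_integral_def)
    next
      case (compl A)
      have "A \<in> sets borel" using compl(1) sets.sigma_sets_subset'[of ?E borel UNIV] E by auto
      then have "set_lebesgue_integral lebesgue ((UNIV - A) \<union> A) f
          = set_lebesgue_integral lebesgue (UNIV - A) f + set_lebesgue_integral lebesgue A f"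
        by (intro set_integral_Un si) auto
      then show ?case using compl f0 by (simp add: set_lebesgue_integral_def)
    next
      case (union A)
      have A: "A i \<in> sets borel" for i
        using union(2) sets.sigma_sets_subset'[of ?E borel UNIV] E by auto
      have "set_lebesgue_integral lebesgue (\<Union>i. A i) f = (\<Sum>i. set_lebesgue_integral lebesgue (A i) f)"
        using A union(1) by (intro lebesgue_integral_countable_add si) (auto simp: disjoint_family_on_def)
      then show ?case using union(3) by simp
    qed
  qed
  \<comment> \<open>A Lebesgue set differs from a Borel set by a null set, which does not change the integral.\<close>
  fix A :: "(real^'n) set" assume "A \<in> sets lebesgue"
  then obtain S N N' where A: "A = S \<union> N" "N \<subseteq> N'" "N' \<in> null_sets lborel" "S \<in> sets lborel"
    by (rule sets_completionE)
  have "AE x in lebesgue. x \<notin> N'" using A(3) by (intro AE_completion AE_not_in)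
  then have "AE x in lebesgue. x \<in> A \<longleftrightarrow> x \<in> S"
    by eventually_elim (use A in auto)
  then have "set_lebesgue_integral lebesgue A f = set_lebesgue_integral lebesgue S f"
    using \<open>A \<in> sets lebesgue\<close> A(4) f
    by (intro set_integral_cong_set)
      (auto simp: set_borel_measurable_def intro!: borel_measurable_scaleR borel_measurable_indicator)
  then show "set_lebesgue_integral lebesgue A f = 0" using borel A(4) by simp
qed

section \<open>Local integrability\<close>

lemma Lp_locD:
  assumes "f \<in> Lp_loc p"
  shows "f \<in> borel_measurable lebesgue"
    and "compact K \<Longrightarrow> integrable lebesgue (\<lambda>x. indicator K x * norm (f x) powr p)"
  using assms by (auto simp: Lp_loc_def set_integrable_def)

text \<open>This single comparison serves both for changing a function on a null set
  (\<open>C = 1\<close>) and for composing with a matrix (\<open>C\<close> its operator norm).\<close>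
lemma Lp_loc_bound:
  assumes f: "f \<in> Lp_loc p" and p: "p \<ge> 0" and g[measurable]: "g \<in> borel_measurable lebesgue"
    and C: "C \<ge> 0" "AE x in lebesgue. norm (g x) \<le> C * norm (f x)"
  shows "g \<in> Lp_loc p"
proof -
  have "integrable lebesgue (\<lambda>x. indicator K x * norm (g x) powr p)" if "compact K" for K
  proof (rule Bochner_Integration.integrable_bound)
    show "integrable lebesgue (\<lambda>x. C powr p * (indicator K x * norm (f x) powr p))"
      using Lp_locD(2)[OF f that] by simp
    have [measurable]: "K \<in> sets lebesgue" using that by (simp add: compact_imp_closed borel_closed)
    show "(\<lambda>x. indicator K x * norm (g x) powr p) \<in> borel_measurable lebesgue"
      by measurable
    show "AE x in lebesgue. norm (indicator K x * norm (g x) powr p)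
        \<le> norm (C powr p * (indicator K x * norm (f x) powr p))"
      using C(2)
    proof eventually_elim
      case (elim x)
      then have "norm (g x) powr p \<le> (C * norm (f x)) powr p" using p by (intro powr_mono2) auto
      also have "\<dots> = C powr p * norm (f x) powr p" using C by (simp add: powr_mult)
      finally show ?case by (simp add: indicator_def)
    qed
  qed
  then show ?thesis using g by (simp add: Lp_loc_def set_integrable_def)
qed

lemma Lp_loc_linear:
  fixes A :: "real^'n^'n"
  assumes f: "f \<in> Lp_loc p" and A: "inj ((*v) A)"
  shows "(\<lambda>x. f (A *v x)) \<in> Lp_loc p"
proof -
  have "integrable lebesgue (\<lambda>x. indicator K x * norm (f (A *v x)) powr p)" if "compact K" for K
  proof -
    have "compact ((*v) A ` K)"
      by (intro compact_continuous_image that linear_continuous_on) simp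
    from integrable_lebesgue_linear[OF _ A Lp_locD(2)[OF f this]] 
    show ?thesis using A by (simp add: indicator_def inj_image_mem_iff)
  qed
  moreover have "(\<lambda>x. f (A *v x)) \<in> borel_measurable lebesgue"
    by (rule measurable_compose[OF measurable_lebesgue_linear[OF _ A] Lp_locD(1)[OF f]]) simp
  ultimately show ?thesis by (simp add: Lp_loc_def set_integrable_def)
qed

lemma Lp_loc_1_diff:
  fixes f g :: "real^'n \<Rightarrow> 'b::euclidean_space"
  assumes f: "f \<in> Lp_loc 1" and g: "g \<in> Lp_loc 1"
  shows "(\<lambda>x. f x - g x) \<in> Lp_loc 1"
proof -
  have [measurable]: "f \<in> borel_measurable lebesgue" "g \<in> borel_measurable lebesgue"
    using f g by (auto dest: Lp_locD(1))
  have "integrable lebesgue (\<lambda>x. indicator K x * norm (f x - g x))" if "compact K" for K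
  proof (rule Bochner_Integration.integrable_bound)
    show "integrable lebesgue (\<lambda>x. indicator K x * norm (f x) + indicator K x * norm (g x))"
      using Lp_locD(2)[OF f that] Lp_locD(2)[OF g that] by simp
    have [measurable]: "K \<in> sets lebesgue" using that by (simp add: compact_imp_closed borel_closed)
    show "(\<lambda>x. indicator K x * norm (f x - g x)) \<in> borel_measurable lebesgue" by measurable
    show "AE x in lebesgue. norm (indicator K x * norm (f x - g x))
        \<le> norm (indicator K x * norm (f x) + indicator K x * norm (g x))"
      by (auto simp: indicator_def norm_triangle_ineq4)
  qed
  then show ?thesis by (simp add: Lp_loc_def set_integrable_def)
qed

lemma integrable_Lp_loc_1_bound:
  fixes f :: "real^'n \<Rightarrow> 'b::euclidean_space" and g :: "real^'n \<Rightarrow> 'c::{banach, second_countable_topology}"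
  assumes f: "f \<in> Lp_loc 1" and g: "g \<in> borel_measurable lebesgue"
    and K: "compact K" "C \<ge> 0" "\<And>x. norm (g x) \<le> C * indicator K x * norm (f x)"
  shows "integrable lebesgue g"
proof (rule Bochner_Integration.integrable_bound[OF _ g])
  show "integrable lebesgue (\<lambda>x. C * (indicator K x * norm (f x)))"
    using Lp_locD(2)[OF f K(1)] by simp
  show "AE x in lebesgue. norm (g x) \<le> norm (C * (indicator K x * norm (f x)))"
    using K(2,3) by (auto simp: mult.assoc)
qed

lemma integrable_C1c_scaleR_Lp_loc:
  assumes f: "f \<in> Lp_loc 1" and \<phi>: "\<phi> \<in> C1c"
  shows "integrable lebesgue (\<lambda>x. \<phi> x *\<^sub>R f x)"
proof -
  obtain K C where K: "compact K" "C \<ge> 0" "\<And>x. \<bar>\<phi> x\<bar> \<le> C * indicator K x"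
    using C1c_support[OF \<phi>] by metis
  show ?thesis
  proof (rule integrable_Lp_loc_1_bound[OF f _ K(1,2)])
    show "(\<lambda>x. \<phi> x *\<^sub>R f x) \<in> borel_measurable lebesgue"
      using C1c_measurable(1)[OF \<phi>] Lp_locD(1)[OF f] by simp
    show "norm (\<phi> x *\<^sub>R f x) \<le> C * indicator K x * norm (f x)" for x
      using mult_right_mono[OF K(3)[of x], of "norm (f x)"] by simp
  qed
qed

lemma integrable_Lp_loc_scaleR_grad:
  assumes f: "f \<in> Lp_loc 1" and \<phi>: "\<phi> \<in> C1c"
  shows "integrable lebesgue (\<lambda>x. f x *\<^sub>R grad \<phi> x)"
proof -
  obtain K C where K: "compact K" "C \<ge> 0" "\<And>x. norm (grad \<phi> x) \<le> C * indicator K x"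
    using C1c_support[OF \<phi>] by metis
  show ?thesis
  proof (rule integrable_Lp_loc_1_bound[OF f _ K(1,2)])
    show "(\<lambda>x. f x *\<^sub>R grad \<phi> x) \<in> borel_measurable lebesgue"
      using C1c_measurable(2)[OF \<phi>] Lp_locD(1)[OF f] by simp
    show "norm (f x *\<^sub>R grad \<phi> x) \<le> C * indicator K x * norm (f x)" for x
      using mult_right_mono[OF K(3)[of x], of "norm (f x)"] by (simp add: mult.commute)
  qed
qed

text \<open>Multiplication by a test function \<open>\<zeta>\<close> that is nonzero exactly on a large ball
  reduces to the integrable case: \<open>\<phi> \<zeta>\<close> is again a test function, and the total integral of \<open>\<zeta> f\<close>
  vanishes because \<open>\<zeta>\<close> itself is a test function.\<close>
lemma AE_eq_0_if_orthogonal_C1c: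
  fixes f :: "real^'n \<Rightarrow> 'b::euclidean_space"
  assumes f: "f \<in> Lp_loc 1"
    and orth: "\<And>\<phi>. \<phi> \<in> C1c \<Longrightarrow> (\<integral>x. \<phi> x *\<^sub>R f x \<partial>lebesgue) = 0"
  shows "AE x in lebesgue. f x = 0"
proof -
  have "AE x in lebesgue. x \<in> ball 0 (real k) \<longrightarrow> f x = 0" for k
  proof -
    obtain \<zeta> where \<zeta>: "\<zeta> \<in> C1c" "{x. \<zeta> x \<noteq> 0} = ball (0::real^'n) (real k)"
      by (rule ball_eq_C1c_support)
    have "AE x in lebesgue. \<zeta> x *\<^sub>R f x = 0"
    proof (rule AE_eq_0_if_integrable_orthogonal_C1c)
      show "integrable lebesgue (\<lambda>x. \<zeta> x *\<^sub>R f x)" by (rule integrable_C1c_scaleR_Lp_loc[OF f \<zeta>(1)])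
      show "(\<integral>x. \<zeta> x *\<^sub>R f x \<partial>lebesgue) = 0" by (rule orth[OF \<zeta>(1)])
      show "(\<integral>x. \<phi> x *\<^sub>R \<zeta> x *\<^sub>R f x \<partial>lebesgue) = 0" if "\<phi> \<in> C1c" for \<phi>
        using orth[OF C1c_mult[OF that \<zeta>(1)]] by simp
    qed
    then show ?thesis by eventually_elim (use \<zeta>(2) in force)
  qed
  then have "AE x in lebesgue. \<forall>k. x \<in> ball 0 (real k) \<longrightarrow> f x = 0"
    by (intro AE_all_countable[THEN iffD2] allI)
  then show ?thesis
  proof eventually_elim
    case (elim x)
    obtain k where "norm x < real k" using reals_Archimedean2 by blast
    then show ?case using elim by auto
  qed
qed

section \<open>Weak gradients under a linear change of variables\<close>

lemma is_weak_grad_unique: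
  assumes G: "is_weak_grad u G" and W: "is_weak_grad u W"
  shows "AE x in lebesgue. G x = W x"
proof -
  have L: "G \<in> Lp_loc 1" "W \<in> Lp_loc 1" using G W by (auto simp: is_weak_grad_def)
  have "AE x in lebesgue. G x - W x = 0"
  proof (rule AE_eq_0_if_orthogonal_C1c[OF Lp_loc_1_diff[OF L]])
    fix \<phi> :: "real^'a \<Rightarrow> real" assume \<phi>: "\<phi> \<in> C1c"
    have "(\<integral>x. \<phi> x *\<^sub>R (G x - W x) \<partial>lebesgue)
        = (\<integral>x. \<phi> x *\<^sub>R G x \<partial>lebesgue) - (\<integral>x. \<phi> x *\<^sub>R W x \<partial>lebesgue)"
      using L \<phi> by (simp add: scaleR_diff_right integrable_C1c_scaleR_Lp_loc)
    also have "\<dots> = 0"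
    proof -
      have "- (\<integral>x. \<phi> x *\<^sub>R F x \<partial>lebesgue) = (\<integral>x. u x *\<^sub>R grad \<phi> x \<partial>lebesgue)"
        if "is_weak_grad u F" for F
        using that \<phi> by (auto simp: is_weak_grad_def)
      from this[OF G] this[OF W]
      have "- (\<integral>x. \<phi> x *\<^sub>R G x \<partial>lebesgue) = - (\<integral>x. \<phi> x *\<^sub>R W x \<partial>lebesgue)" by simp
      then show ?thesis by simp
    qed
    finally show "(\<integral>x. \<phi> x *\<^sub>R (G x - W x) \<partial>lebesgue) = 0" .
  qed
  then show ?thesis by simp
qed

text \<open>The chosen representative is some weak gradient, not necessarily the one that is
  assumed to be locally \<open>p\<close>-integrable; uniqueness transfers the integrability.\<close>
lemma weak_grad_W1p_loc:
  assumes u: "u \<in> W1p_loc p" and p: "p \<ge> 0"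
  shows "is_weak_grad u (weak_grad u)" "weak_grad u \<in> Lp_loc p"
proof -
  obtain G where G: "is_weak_grad u G" "G \<in> Lp_loc p" using u by (auto simp: W1p_loc_def)
  show W: "is_weak_grad u (weak_grad u)" unfolding weak_grad_def by (rule someI[of "is_weak_grad u", OF G(1)])
  have "weak_grad u \<in> borel_measurable lebesgue"
    using W by (auto simp: is_weak_grad_def dest: Lp_locD(1))
  moreover have "AE x in lebesgue. norm (weak_grad u x) \<le> 1 * norm (G x)"
    using is_weak_grad_unique[OF W G(1)] by eventually_elim simp
  ultimately show "weak_grad u \<in> Lp_loc p" by (rule Lp_loc_bound[OF G(2) p _ zero_le_one])
qed

lemma Lp_loc_matrix_mult:
  fixes A :: "real^'n^'n" and f :: "real^'n \<Rightarrow> real^'n"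
  assumes f: "f \<in> Lp_loc p" and p: "p \<ge> 0"
  shows "(\<lambda>x. A *v f x) \<in> Lp_loc p"
proof (rule Lp_loc_bound[OF f p])
  show "(\<lambda>x. A *v f x) \<in> borel_measurable lebesgue"
    by (rule measurable_compose[OF Lp_locD(1)[OF f]])
       (intro borel_measurable_continuous_onI linear_continuous_on, simp)
  show "onorm ((*v) A) \<ge> 0" by (rule onorm_pos_le) simp
  show "AE x in lebesgue. norm (A *v f x) \<le> onorm ((*v) A) * norm (f x)"
    by (intro AE_I2 onorm) simp
qed

text \<open>A test function \<open>\<phi>\<close> is written as \<open>\<psi> \<circ> A\<close> with \<open>\<psi> = \<phi> \<circ> A\<^sup>-\<^sup>1\<close>.  Then
  \<open>\<nabla>\<phi> = A\<^sup>T (\<nabla>\<psi> \<circ> A)\<close>, the substitution \<open>y = A x\<close> leads to the defining identity of \<open>G\<close> tested with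
  \<open>\<psi>\<close>, and the same substitution leads back.\<close>
lemma is_weak_grad_linear:
  fixes A :: "real^'n^'n"
  assumes G: "is_weak_grad u G" and A: "invertible A"
  shows "is_weak_grad (\<lambda>x. u (A *v x)) (\<lambda>x. transpose A *v G (A *v x))"
proof -
  have inj: "inj ((*v) A)" using A by (simp add: inj_matrix_vector_mult)
  have L: "u \<in> Lp_loc 1" "G \<in> Lp_loc 1" using G by (auto simp: is_weak_grad_def)
  have bl: "bounded_linear ((*v) (transpose A))" by simp
  obtain A' where A': "A ** A' = mat 1" "A' ** A = mat 1" using A by (auto simp: invertible_def)
  then have A'_inv: "invertible A'" by (auto simp: invertible_def)
  obtain c :: real where c: "c > 0"
    "\<And>f :: real^'n \<Rightarrow> real^'n. f \<in> borel_measurable lebesgue \<Longrightarrow>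
        (\<integral>x. f x \<partial>lebesgue) = c *\<^sub>R (\<integral>x. f (A *v x) \<partial>lebesgue)"
    using integral_lebesgue_linear[OF _ inj, where 'b="real^'n"] by auto
  have "(\<integral>x. u (A *v x) *\<^sub>R grad \<phi> x \<partial>lebesgue)
      = - (\<integral>x. \<phi> x *\<^sub>R (transpose A *v G (A *v x)) \<partial>lebesgue)" if \<phi>: "\<phi> \<in> C1c" for \<phi>
  proof -
    define \<psi> where "\<psi> = (\<lambda>y. \<phi> (A' *v y))"
    have \<psi>: "\<psi> \<in> C1c" unfolding \<psi>_def by (rule C1c_linear(1)[OF \<phi> A'_inv])
    have \<phi>_eq: "\<phi> = (\<lambda>x. \<psi> (A *v x))" by (simp add: \<psi>_def matrix_vector_mul_assoc A')
    have gr: "grad \<phi> x = transpose A *v grad \<psi> (A *v x)" for x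
      unfolding \<phi>_eq by (rule C1c_linear(2)[OF \<psi> A])
    have iu: "integrable lebesgue (\<lambda>x. u x *\<^sub>R grad \<psi> x)"
      by (rule integrable_Lp_loc_scaleR_grad[OF L(1) \<psi>])
    have iG: "integrable lebesgue (\<lambda>x. \<psi> x *\<^sub>R G x)"
      by (rule integrable_C1c_scaleR_Lp_loc[OF L(2) \<psi>])
    \<comment> \<open>The change of variables for both integrands; the common factor \<open>1 / c\<close> cancels.\<close>
    have lin: "(\<integral>x. transpose A *v F (A *v x) \<partial>lebesgue)
        = (1 / c) *\<^sub>R (transpose A *v (\<integral>x. F x \<partial>lebesgue))"
      if "integrable lebesgue F" for F :: "real^'n \<Rightarrow> real^'n"
    proof -
      have "integrable lebesgue (\<lambda>x. F (A *v x))"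
        by (rule integrable_lebesgue_linear[OF _ inj that]) simp
      then have "(\<integral>x. transpose A *v F (A *v x) \<partial>lebesgue) = transpose A *v (\<integral>x. F (A *v x) \<partial>lebesgue)"
        by (rule integral_bounded_linear[OF bl])
      also have "(\<integral>x. F (A *v x) \<partial>lebesgue) = (1 / c) *\<^sub>R (\<integral>x. F x \<partial>lebesgue)"
        using c(1) c(2)[OF borel_measurable_integrable[OF that]] by simp
      finally show ?thesis by (simp add: matrix_vector_mult_scaleR)
    qed
    have "(\<integral>x. u (A *v x) *\<^sub>R grad \<phi> x \<partial>lebesgue)
        = (\<integral>x. transpose A *v (u (A *v x) *\<^sub>R grad \<psi> (A *v x)) \<partial>lebesgue)"
      by (simp add: gr matrix_vector_mult_scaleR)
    also have "\<dots> = (1 / c) *\<^sub>R (transpose A *v (\<integral>x. u x *\<^sub>R grad \<psi> x \<partial>lebesgue))"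
      by (rule lin[OF iu])
    also have "\<dots> = (1 / c) *\<^sub>R (transpose A *v - (\<integral>x. \<psi> x *\<^sub>R G x \<partial>lebesgue))"
      using G \<psi> by (simp add: is_weak_grad_def)
    also have "\<dots> = - ((1 / c) *\<^sub>R (transpose A *v (\<integral>x. \<psi> x *\<^sub>R G x \<partial>lebesgue)))"
      using linear_neg[OF bounded_linear.linear[OF bl]] by simp
    also have "\<dots> = - (\<integral>x. transpose A *v (\<psi> (A *v x) *\<^sub>R G (A *v x)) \<partial>lebesgue)"
      using lin[OF iG] by simp
    also have "\<dots> = - (\<integral>x. \<phi> x *\<^sub>R (transpose A *v G (A *v x)) \<partial>lebesgue)"
      by (simp add: \<phi>_eq matrix_vector_mult_scaleR)
    finally show ?thesis .
  qed
  then show ?thesis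
    using Lp_loc_linear[OF L(1) inj] Lp_loc_matrix_mult[OF Lp_loc_linear[OF L(2) inj]]
    by (simp add: is_weak_grad_def del: transpose_matrix_vector)
qed

lemma W1p_loc_linear:
  fixes A :: "real^'n^'n"
  assumes u: "u \<in> W1p_loc p" and A: "invertible A" and p: "p \<ge> 0"
  shows "(\<lambda>x. u (A *v x)) \<in> W1p_loc p"
    and "AE x in lebesgue. weak_grad (\<lambda>x. u (A *v x)) x = transpose A *v weak_grad u (A *v x)"
    and "(\<lambda>x. transpose A *v weak_grad u (A *v x)) \<in> Lp_loc p"
proof -
  have inj: "inj ((*v) A)" using A by (simp add: inj_matrix_vector_mult)
  note W = weak_grad_W1p_loc[OF u p] and G = is_weak_grad_linear[OF weak_grad_W1p_loc(1)[OF u p] A]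
  show L: "(\<lambda>x. transpose A *v weak_grad u (A *v x)) \<in> Lp_loc p"
    by (rule Lp_loc_matrix_mult[OF Lp_loc_linear[OF W(2) inj] p])
  show u': "(\<lambda>x. u (A *v x)) \<in> W1p_loc p"
    using u G L Lp_loc_linear[OF _ inj] unfolding W1p_loc_def by blast
  show "AE x in lebesgue. weak_grad (\<lambda>x. u (A *v x)) x = transpose A *v weak_grad u (A *v x)"
    by (rule is_weak_grad_unique[OF weak_grad_W1p_loc(1)[OF u' p] G])
qed

section \<open>The two vector fields\<close>

text \<open>The field has norm \<open>|G|\<^bsup>p-1\<^esup> \<le> 1 + |G|\<^bsup>p\<^esup>\<close>, and \<open>\<nabla>\<phi>\<close> is bounded with compact
  support.\<close>
lemma integrable_euclidean_field_grad:
  assumes G: "G \<in> Lp_loc p" and p: "p > 1" and \<phi>: "\<phi> \<in> C1c"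
  shows "integrable lebesgue (\<lambda>x. euclidean_field p (G x) \<bullet> grad \<phi> x)"
proof -
  obtain K C where K: "compact K" "C \<ge> 0" "\<And>x. norm (grad \<phi> x) \<le> C * indicator K x"
    using C1c_support[OF \<phi>] by metis
  have [measurable]: "G \<in> borel_measurable lebesgue" "grad \<phi> \<in> borel_measurable lebesgue"
    using Lp_locD(1)[OF G] C1c_measurable(2)[OF \<phi>] by auto
  show ?thesis
  proof (rule Bochner_Integration.integrable_bound)
    have "integrable lebesgue (\<lambda>x. indicator K x :: real)"
      using emeasure_compact_finite[OF K(1)] K(1)
      by (intro integrable_real_indicator) (auto simp: compact_imp_closed borel_closed)
    then show "integrable lebesgue (\<lambda>x. C * (indicator K x + indicator K x * norm (G x) powr p))"
      using Lp_locD(2)[OF G K(1)] by simp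
    show "(\<lambda>x. euclidean_field p (G x) \<bullet> grad \<phi> x) \<in> borel_measurable lebesgue"
      unfolding euclidean_field_def by measurable
    show "AE x in lebesgue. norm (euclidean_field p (G x) \<bullet> grad \<phi> x)
        \<le> norm (C * (indicator K x + indicator K x * norm (G x) powr p))"
    proof (rule AE_I2)
      fix x
      have "norm (euclidean_field p (G x)) = norm (G x) powr (p - 1)"
        using powr_add[of "norm (G x)" "p - 2" 1] by (auto simp: euclidean_field_def)
      also have "\<dots> \<le> 1 + norm (G x) powr p"
      proof (cases "norm (G x) \<le> 1")
        case True
        then have "norm (G x) powr (p - 1) \<le> 1" using p by (intro powr_le1) auto
        then show ?thesis by (simp add: add_increasing2)
      next
        case False
        then have "norm (G x) powr (p - 1) \<le> norm (G x) powr p" by (intro powr_mono) auto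
        then show ?thesis by simp
      qed
      finally have "norm (euclidean_field p (G x)) * norm (grad \<phi> x)
          \<le> (1 + norm (G x) powr p) * (C * indicator K x)"
        using K(3) by (intro mult_mono) auto
      then have "\<bar>euclidean_field p (G x) \<bullet> grad \<phi> x\<bar> \<le> (1 + norm (G x) powr p) * (C * indicator K x)"
        using Cauchy_Schwarz_ineq2 order_trans by blast
      also have "\<dots> = C * (indicator K x + indicator K x * norm (G x) powr p)"
        by (simp add: algebra_simps)
      finally show "norm (euclidean_field p (G x) \<bullet> grad \<phi> x)
        \<le> norm (C * (indicator K x + indicator K x * norm (G x) powr p))"
        by simp
    qed
  qed
qed

text \<open>The chain rule gives \<open>\<nabla>H(\<xi>) = B\<^sup>T (B \<xi>) / |B \<xi>|\<close> for \<open>H(\<xi>) = |B \<xi>|\<close> and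
  \<open>\<xi> \<noteq> 0\<close>, so that \<open>H\<^bsup>p-1\<^esup>(\<xi>) \<nabla>H(\<xi>) \<cdot> \<eta> = |B \<xi>|\<^bsup>p-2\<^esup> (B \<xi>) \<cdot> (B \<eta>)\<close>.  Injectivity of \<open>B\<close> makes the
  two conventions at the origin agree.\<close>
lemma finsler_field_norm_matrix:
  fixes B :: "real^'n^'n"
  assumes B: "invertible B"
  shows "finsler_field p (\<lambda>\<xi>. norm (B *v \<xi>)) \<xi> \<bullet> \<eta> = euclidean_field p (B *v \<xi>) \<bullet> (B *v \<eta>)"
proof (cases "\<xi> = 0")
  case True
  then show ?thesis by (simp add: finsler_field_def euclidean_field_def)
next
  case False
  have inj: "inj ((*v) B)" using B by (simp add: inj_matrix_vector_mult)
  have nz: "B *v \<xi> \<noteq> 0" using False injD[OF inj, of \<xi> 0] by auto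
  have "((\<lambda>\<xi>. norm (B *v \<xi>)) has_derivative (\<lambda>h. sgn (B *v \<xi>) \<bullet> (B *v h))) (at \<xi>)"
  proof -
    have "((*v) B has_derivative (*v) B) (at \<xi>)"
      by (rule bounded_linear_imp_has_derivative) simp
    from has_derivative_compose[OF this has_derivative_norm[OF nz]] show ?thesis
      by (simp add: inner_commute)
  qed
  then have "grad (\<lambda>\<xi>. norm (B *v \<xi>)) \<xi> = transpose B *v sgn (B *v \<xi>)"
    by (intro grad_eqI) (simp add: dot_lmul_matrix vector_transpose_matrix)
  then have "finsler_field p (\<lambda>\<xi>. norm (B *v \<xi>)) \<xi> \<bullet> \<eta>
      = norm (B *v \<xi>) powr (p - 1) * (sgn (B *v \<xi>) \<bullet> (B *v \<eta>))"
    using False by (simp add: finsler_field_def dot_lmul_matrix vector_transpose_matrix)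
  also have "\<dots> = (norm (B *v \<xi>) powr (p - 1) / norm (B *v \<xi>)) * ((B *v \<xi>) \<bullet> (B *v \<eta>))"
    by (simp add: sgn_div_norm divide_simps)
  also have "norm (B *v \<xi>) powr (p - 1) / norm (B *v \<xi>) = norm (B *v \<xi>) powr (p - 2)"
    using nz powr_diff[of "norm (B *v \<xi>)" "p - 1" 1] by simp
  finally show ?thesis using nz by (simp add: euclidean_field_def)
qed

theorem theorem1p1:
  fixes M B :: "real^'n^'n"
    and H :: "real^'n \<Rightarrow> real"
    and u u' :: "real^'n \<Rightarrow> real"
    and p :: real
  assumes "CARD('n) \<ge> 2"
    and "sym_pos_def M"
    and "H = (\<lambda>\<xi>. sqrt ((M *v \<xi>) \<bullet> \<xi>))"
    and "sym_pos_def B" and "B ** B = M"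
    and "p > 1"
    and "u \<in> W1p_loc p"
    and "u' = (\<lambda>x. u (B *v x))"
  shows "u' \<in> W1p_loc p \<and>
    (\<forall>\<phi>\<in>C1c. \<forall>\<phi>' F.
      \<phi>' = (\<lambda>x. \<phi> (B *v x)) \<longrightarrow>
      F = (\<lambda>y. finsler_field p H (weak_grad u y) \<bullet> grad \<phi> y) \<longrightarrow>
        integrable lebesgue (\<lambda>x. euclidean_field p (weak_grad u' x) \<bullet> grad \<phi>' x) \<and>
        integrable lebesgue (\<lambda>x. F (B *v x)) \<and>
        (\<integral>x. euclidean_field p (weak_grad u' x) \<bullet> grad \<phi>' x \<partial>lebesgue)
          = (\<integral>x. F (B *v x) \<partial>lebesgue))"
proof -
  have sym: "transpose B = B" and pos: "\<And>x. x \<noteq> 0 \<Longrightarrow> (B *v x) \<bullet> x > 0"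
    using \<open>sym_pos_def B\<close> by (auto simp: sym_pos_def_def)
  have "B *v x = 0 \<Longrightarrow> x = 0" for x using pos[of x] by force
  then have "\<exists>B'. B' ** B = mat 1" by (simp add: matrix_left_invertible_ker)
  then have inv: "invertible B" by (simp add: invertible_left_inverse)
  \<comment> \<open>Symmetry of \<open>B\<close> turns \<open>M = B\<^sup>2\<close> into \<open>M = B\<^sup>T B\<close>.\<close>
  have H: "H = (\<lambda>\<xi>. norm (B *v \<xi>))"
  proof -
    have "(M *v \<xi>) \<bullet> \<xi> = (B *v \<xi>) \<bullet> (B *v \<xi>)" for \<xi>
    proof -
      have "(M *v \<xi>) \<bullet> \<xi> = (transpose B *v (B *v \<xi>)) \<bullet> \<xi>"
        using \<open>B ** B = M\<close> sym by (simp add: matrix_vector_mul_assoc)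
      then show ?thesis by (simp add: dot_lmul_matrix vector_transpose_matrix)
    qed
    then show ?thesis using assms(3) by (simp add: norm_eq_sqrt_inner)
  qed
  note u' = W1p_loc_linear[OF \<open>u \<in> W1p_loc p\<close> inv, folded \<open>u' = (\<lambda>x. u (B *v x))\<close>, unfolded sym]
  have p: "p \<ge> 0" using \<open>p > 1\<close> by simp
  have main: "integrable lebesgue (\<lambda>x. euclidean_field p (weak_grad u' x) \<bullet> grad \<phi>' x) \<and>
        integrable lebesgue (\<lambda>x. F (B *v x)) \<and>
        (\<integral>x. euclidean_field p (weak_grad u' x) \<bullet> grad \<phi>' x \<partial>lebesgue)
          = (\<integral>x. F (B *v x) \<partial>lebesgue)"
    if \<phi>: "\<phi> \<in> C1c" and \<phi>': "\<phi>' = (\<lambda>x. \<phi> (B *v x))"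
      and F: "F = (\<lambda>y. finsler_field p H (weak_grad u y) \<bullet> grad \<phi> y)" for \<phi> \<phi>' F
  proof -
    have "\<phi>' \<in> C1c" unfolding \<phi>' by (rule C1c_linear(1)[OF \<phi> inv])
    have FB: "F (B *v x) = euclidean_field p (B *v weak_grad u (B *v x)) \<bullet> grad \<phi>' x" for x
      unfolding F H \<phi>' C1c_linear(2)[OF \<phi> inv] sym by (rule finsler_field_norm_matrix[OF inv])
    have int: "integrable lebesgue (\<lambda>x. euclidean_field p (weak_grad u' x) \<bullet> grad \<phi>' x)"
      by (rule integrable_euclidean_field_grad[OF weak_grad_W1p_loc(2)[OF u'(1)[OF p] p] \<open>p > 1\<close> \<open>\<phi>' \<in> C1c\<close>])
    moreover have intF: "integrable lebesgue (\<lambda>x. F (B *v x))"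
      unfolding FB by (rule integrable_euclidean_field_grad[OF u'(3)[OF p] \<open>p > 1\<close> \<open>\<phi>' \<in> C1c\<close>])
    moreover have "(\<integral>x. euclidean_field p (weak_grad u' x) \<bullet> grad \<phi>' x \<partial>lebesgue)
          = (\<integral>x. F (B *v x) \<partial>lebesgue)"
    proof (rule integral_cong_AE)
      show "AE x in lebesgue. euclidean_field p (weak_grad u' x) \<bullet> grad \<phi>' x = F (B *v x)"
        using u'(2)[OF p] by eventually_elim (simp add: FB)
    qed (use int intF in auto)
    ultimately show ?thesis by blast
  qed
  then show ?thesis using u'(1)[OF p] by blast
qed

end
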